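(* Let $L>0$ and let $m=n$ be a continuous function on $[0,L]$ bounded below by some positive constant. Fix an angle $\theta\in(0,\pi/2)$. For each choice of sign $\pm$, the curves $\mathcal{C}_k^\pm$ of the Fučík spectrum of the problem $-u''=\alpha m(x)u^+-\beta m(x)u^-$ on $(0,L)$, $u(0)=u(L)=0$, have the following asymptotic behavior in the region $\mathcal{K}_\theta$: if $(\alpha_k^\pm,\beta_k^\pm)\in\mathcal{C}_k^\pm\cap\mathcal{K}_\theta$, then $$1\sim \frac{\pi k}{2}\left(\frac{(\alpha_k^\pm)^{-\frac12}+(\beta_k^\pm)^{-\frac12}}{\int_0^L m(x)^{\frac12}\,dx}\right)\qquad\text{as } k\to\infty.$$
   Context: For a function $u$, $u^\pm=\max\{0,\pm u\}$. For weights $m,n\in C[0,L]$, each bounded below by a positive constant, consider, for $\alpha,\beta>0$, the problem $$-u''=\alpha\, m(x)u^+-\beta\, n(x)u^-\ \text{ in }(0,L),\qquad u(0)=u(L)=0.$$ The Fučík spectrum $\Sigma$ is the set of pairs $(\alpha,\beta)$ for which this problem has a nontrivial solution. For $k\in\mathbb{N}$, $\mathcal{C}_k^+$ (resp. $\mathcal{C}_k^-$) is the set of pairs $(\alpha,\beta)$ for which there is a nontrivial solution $u$ with exactly $k$ nodal domains in $(0,L)$ (i.e. $k+1$ zeros in $[0,L]$) and $u'(0)>0$ (resp. $u'(0)<0$). $\mathcal{K}_\theta$ denotes the region of the first quadrant, symmetric with respect to the line $x=y$, lying between two rays through the origin which form an angle $\theta$. The notation $f(k)\sim g(k)$ as $k\to\infty$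 means $\lim_{k\to\infty}f(k)/g(k)=1$. *)

theory Defs
  imports "HOL-Analysis.Analysis" "HOL-Library.Landau_Symbols"
begin

definition pos_part :: "real \<Rightarrow> real" where
  "pos_part t = max 0 t"

definition neg_part :: "real \<Rightarrow> real" where
  "neg_part t = max 0 (- t)"

(* u is a classical solution, u' its derivative. Derivatives are taken within {0..L}, so u' 0 is the
   one-sided derivative at 0; the values of u, u' and of the weights outside {0..L} play no role. *)
definition fucik_solution ::
  "real \<Rightarrow> (real \<Rightarrow> real) \<Rightarrow> (real \<Rightarrow> real) \<Rightarrow> real \<Rightarrow> real \<Rightarrow> (real \<Rightarrow> real) \<Rightarrow> (real \<Rightarrow> real) \<Rightarrow> bool" where
  "fucik_solution L m n \<alpha> \<beta> u u' \<longleftrightarrow>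
     (\<forall>x\<in>{0..L}. (u has_real_derivative u' x) (at x within {0..L})) \<and>
     continuous_on {0..L} u' \<and>
     (\<forall>x\<in>{0<..<L}. \<exists>u''. (u' has_real_derivative u'') (at x) \<and>
        - u'' = \<alpha> * m x * pos_part (u x) - \<beta> * n x * neg_part (u x)) \<and>
     u 0 = 0 \<and> u L = 0"

definition nodal_domains :: "real \<Rightarrow> (real \<Rightarrow> real) \<Rightarrow> real set set" where
  "nodal_domains L u = components {x \<in> {0<..<L}. u x \<noteq> 0}"

(* The sign \<sigma> is 1 for the curve with u'(0) > 0 and -1 for the one with u'(0) < 0. *)
definition fucik_curve ::
  "real \<Rightarrow> real \<Rightarrow> (real \<Rightarrow> real) \<Rightarrow> (real \<Rightarrow> real) \<Rightarrow> nat \<Rightarrow> (real \<times> real) set" where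
  "fucik_curve \<sigma> L m n k = {(\<alpha>, \<beta>). \<alpha> > 0 \<and> \<beta> > 0 \<and>
     (\<exists>u u'. fucik_solution L m n \<alpha> \<beta> u u' \<and> (\<exists>x\<in>{0..L}. u x \<noteq> 0) \<and>
        finite (nodal_domains L u) \<and> card (nodal_domains L u) = k \<and> \<sigma> * u' 0 > 0)}"

(* Polar coordinates; the two bounding rays are included, the origin is not. *)
definition sector :: "real \<Rightarrow> (real \<times> real) set" where
  "sector \<theta> = {(r * cos \<phi>, r * sin \<phi>) | r \<phi>. r > 0 \<and> \<bar>\<phi> - pi / 4\<bar> \<le> \<theta> / 2}"

end

theory Submission imports Defs begin

text \<open>Cut \<open>{0..L}\<close> at the zeros \<open>z 0 < \<dots> < z k\<close> of a solution with \<open>k\<close> nodal domains. On the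
  nodal interval from \<open>z i\<close> to \<open>z (i+1)\<close> the equation is linear, \<open>- u'' = \<lambda> m u\<close>, where \<open>\<lambda>\<close> is
  \<open>\<alpha>\<close> or \<open>\<beta>\<close> according to the sign of \<open>u\<close>. Comparing \<open>u\<close> with the sine that has the same two zeros
  gives a point \<open>\<xi> i\<close> of the interval at which \<open>\<lambda> * m (\<xi> i) = (pi / (z (i+1) - z i))\<^sup>2\<close>
  (\<open>sturm_mean_value\<close>); in other words
  \<open>sqrt (m (\<xi> i)) * (z (i+1) - z i) = pi / sqrt \<lambda>\<close> exactly.

  Sum this over the nodal intervals. The left sides add up to a Riemann sum of \<open>sqrt m\<close>. The right sides
  add up to \<open>pi * k / 2 * (1 / sqrt \<alpha> + 1 / sqrt \<beta>)\<close> up to one half term, because \<open>u\<close> changes sign at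
  each of its interior zeros (\<open>nodal_partition\<close>), all of which are simple. Hence everything reduces to
  the mesh tending to \<open>0\<close> as \<open>k\<close> grows.

  This is where the sector enters. The sum identity and the boundedness of \<open>m\<close> show that the smaller of
  \<open>1 / sqrt \<alpha>\<close> and \<open>1 / sqrt \<beta>\<close> is \<open>O(1 / k)\<close>; the sector keeps \<open>\<alpha> / \<beta>\<close> between
  positive constants, so the larger one is \<open>O(1 / k)\<close> too. By the identity on a single interval and the
  lower bound for \<open>m\<close>, so are the lengths of all nodal intervals, and the half term that parity leaves
  over vanishes as well.\<close>

section \<open>Zeros of solutions\<close>

text \<open>Uniqueness for the initial value problem with zero data, in the form that shows every zero of a
  nontrivial solution to be simple. The energy \<open>E = u\<^sup>2 + u'\<^sup>2\<close> satisfies \<open>\<bar>E'\<bar> \<le> C * E\<close>, so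
  \<open>E * exp (- C * t)\<close> decreases and \<open>E * exp (C * t)\<close> increases; \<open>E z = 0\<close> then forces \<open>E = 0\<close> to
  the right of \<open>z\<close> by the first fact and to the left by the second.\<close>

lemma linear_bound_unique_zero:
  fixes u u' :: "real \<Rightarrow> real"
  assumes du: "\<And>x. x \<in> {a..b} \<Longrightarrow> (u has_real_derivative u' x) (at x within {a..b})"
    and cu': "continuous_on {a..b} u'"
    and du': "\<And>x. x \<in> {a<..<b} \<Longrightarrow> \<exists>d. (u' has_real_derivative d) (at x) \<and> \<bar>d\<bar> \<le> K * \<bar>u x\<bar>"
    and z: "z \<in> {a..b}" "u z = 0" "u' z = 0"
    and x: "x \<in> {a..b}"
  shows "u x = 0"
proof -
  define E where "E = (\<lambda>t. (u t)\<^sup>2 + (u' t)\<^sup>2)"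
  define C where "C = 1 + \<bar>K\<bar>"
  have cu: "continuous_on {a..b} u"
    using du by (intro DERIV_continuous_on)
  have dE: "\<exists>d. (E has_real_derivative d) (at t) \<and> \<bar>d\<bar> \<le> C * E t" if t: "t \<in> {a<..<b}" for t
  proof -
    obtain d where d: "(u' has_real_derivative d) (at t)" "\<bar>d\<bar> \<le> K * \<bar>u t\<bar>"
      using du'[OF t] by blast
    have u1: "(u has_real_derivative u' t) (at t)"
      using du[of t] t by (simp add: at_within_Icc_at)
    have "(E has_real_derivative 2 * u t * u' t + 2 * u' t * d) (at t)"
      unfolding E_def by (auto intro!: derivative_eq_intros u1 d)
    moreover have "\<bar>2 * u t * u' t + 2 * u' t * d\<bar> \<le> C * E t"
    proof -
      have y: "2 * \<bar>u t\<bar> * \<bar>u' t\<bar> \<le> E t"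
        using sum_squares_bound[of "\<bar>u t\<bar>" "\<bar>u' t\<bar>"] by (simp add: E_def)
      have "\<bar>d\<bar> \<le> \<bar>K\<bar> * \<bar>u t\<bar>"
        using d(2) mult_right_mono[of K "\<bar>K\<bar>" "\<bar>u t\<bar>"] by linarith
      then have "2 * \<bar>u' t\<bar> * \<bar>d\<bar> \<le> 2 * \<bar>u' t\<bar> * (\<bar>K\<bar> * \<bar>u t\<bar>)"
        by (intro mult_left_mono) auto
      also have "\<dots> = \<bar>K\<bar> * (2 * \<bar>u t\<bar> * \<bar>u' t\<bar>)" by simp
      also have "\<dots> \<le> \<bar>K\<bar> * E t" using y by (intro mult_left_mono) auto
      finally have "2 * \<bar>u' t\<bar> * \<bar>d\<bar> \<le> \<bar>K\<bar> * E t" .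
      moreover have "\<bar>2 * u t * u' t + 2 * u' t * d\<bar> \<le> 2 * \<bar>u t\<bar> * \<bar>u' t\<bar> + 2 * \<bar>u' t\<bar> * \<bar>d\<bar>"
        using abs_triangle_ineq[of "2 * u t * u' t" "2 * u' t * d"] by (simp add: abs_mult)
      ultimately show ?thesis using y by (simp add: C_def algebra_simps)
    qed
    ultimately show ?thesis by blast
  qed
  have cE: "continuous_on S (\<lambda>t. E t * exp (r * t))" if "S \<subseteq> {a..b}" for S r
    unfolding E_def using cu cu' that
    by (intro continuous_intros) (auto intro: continuous_on_subset)
  have dG: "\<exists>d. ((\<lambda>t. E t * exp (r * t)) has_real_derivative (d + r * E t) * exp (r * t)) (at t)
      \<and> \<bar>d\<bar> \<le> C * E t" if "t \<in> {a<..<b}" for t r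
  proof -
    obtain d where d: "(E has_real_derivative d) (at t)" "\<bar>d\<bar> \<le> C * E t"
      using dE[OF \<open>t \<in> _\<close>] by blast
    have "((\<lambda>t. E t * exp (r * t)) has_real_derivative (d + r * E t) * exp (r * t)) (at t)"
      by (auto intro!: derivative_eq_intros d simp: algebra_simps)
    with d show ?thesis by blast
  qed
  have Ez: "E z = 0" using z by (simp add: E_def)
  have "E x * exp (r * x) \<le> 0" if "r = (if z \<le> x then - C else C)" for r
  proof (cases "z \<le> x")
    case True
    have "E x * exp (r * x) \<le> E z * exp (r * z)"
    proof (rule DERIV_nonpos_imp_decreasing_open[where f = "\<lambda>t. E t * exp (r * t)", OF True])
      fix t assume t: "z < t" "t < x"
      then have "t \<in> {a<..<b}" using z(1) x by auto
      from dG[OF this, of r] obtain d where d: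
        "((\<lambda>t. E t * exp (r * t)) has_real_derivative (d + r * E t) * exp (r * t)) (at t)"
        "\<bar>d\<bar> \<le> C * E t" by blast
      have "(d + r * E t) * exp (r * t) \<le> 0"
        using d(2) that True by (intro mult_nonpos_nonneg) auto
      with d show "\<exists>y. ((\<lambda>t. E t * exp (r * t)) has_real_derivative y) (at t) \<and> y \<le> 0"
        by blast
    qed (use z(1) x in \<open>auto intro!: cE\<close>)
    then show ?thesis using Ez by simp
  next
    case False
    have "E x * exp (r * x) \<le> E z * exp (r * z)"
    proof (rule DERIV_nonneg_imp_increasing_open[where f = "\<lambda>t. E t * exp (r * t)"])
      fix t assume t: "x < t" "t < z"
      then have "t \<in> {a<..<b}" using z(1) x by auto
      from dG[OF this, of r] obtain d where d:
        "((\<lambda>t. E t * exp (r * t)) has_real_derivative (d + r * E t) * exp (r * t)) (at t)"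
        "\<bar>d\<bar> \<le> C * E t" by blast
      have "(d + r * E t) * exp (r * t) \<ge> 0"
        using d(2) that False by (intro mult_nonneg_nonneg) auto
      with d show "\<exists>y. ((\<lambda>t. E t * exp (r * t)) has_real_derivative y) (at t) \<and> y \<ge> 0"
        by blast
    qed (use z(1) x False in \<open>auto intro!: cE\<close>)
    then show ?thesis using Ez by simp
  qed
  then have "E x \<le> 0" by (simp add: mult_le_0_iff)
  then show "u x = 0"
    using sum_power2_le_zero_iff[of "u x" "u' x"] by (simp add: E_def)
qed

text \<open>Infinitely many zeros in a compact interval would accumulate at a zero, and there the difference
  quotients along the other zeros vanish, so the derivative would be \<open>0\<close>.\<close>

lemma finite_zeros_if_simple:
  fixes u u' :: "real \<Rightarrow> real"
  assumes du: "\<And>x. x \<in> {a..b} \<Longrightarrow> (u has_real_derivative u' x) (at x within {a..b})"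
    and simple: "\<And>x. x \<in> {a..b} \<Longrightarrow> u x = 0 \<Longrightarrow> u' x \<noteq> 0"
  shows "finite {x \<in> {a..b}. u x = 0}"
proof (rule ccontr)
  let ?Z = "{x \<in> {a..b}. u x = 0}"
  assume inf: "infinite ?Z"
  have cu: "continuous_on {a..b} u"
    using du by (intro DERIV_continuous_on)
  have "closed ?Z"
    using continuous_closed_preimage_constant[OF cu, of 0] by simp
  moreover have "bounded ?Z"
    by (rule bounded_subset[of "{a..b}"]) auto
  ultimately have "compact ?Z"
    by (simp add: compact_eq_bounded_closed)
  then obtain z where z: "z \<in> ?Z" "z islimpt ?Z"
    using inf by (auto simp: compact_eq_Bolzano_Weierstrass)
  have "((\<lambda>y. (u y - u z) / (y - z)) \<longlongrightarrow> u' z) (at z within {a..b})"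
    using du[of z] z by (simp add: has_field_derivative_iff)
  then have "\<forall>\<^sub>F y in at z within {a..b}. (u y - u z) / (y - z) \<noteq> 0"
    using simple z by (intro tendsto_imp_eventually_ne) auto
  then have "\<forall>\<^sub>F y in at z. y \<notin> ?Z"
    using z by (auto simp: eventually_at_filter elim!: eventually_mono)
  then show False
    using z(2) by (simp add: islimpt_iff_eventually)
qed

lemma finite_set_partition:
  fixes Z :: "real set"
  assumes "finite Z" "a \<in> Z" "b \<in> Z" "Z \<subseteq> {a..b}"
  obtains z :: "nat \<Rightarrow> real" and n where "z 0 = a" "z n = b" "strict_mono_on {..n} z" "z ` {..n} = Z"
proof -
  define l where "l = sorted_list_of_set Z"
  define n where "n = card Z - 1"
  have "card Z > 0" using assms by (auto simp: card_gt_0_iff)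
  then have len: "length l = Suc n" by (simp add: l_def n_def)
  have set: "set l = Z" using assms by (simp add: l_def)
  have "sorted_wrt (<) l" by (simp add: l_def)
  then have mono: "strict_mono_on {..n} (\<lambda>i. l ! i)"
    using len by (auto simp: strict_mono_on_def sorted_wrt_iff_nth_less)
  have img: "(!) l ` {..n} = Z"
    using set len by (force simp: set_conv_nth image_def less_Suc_eq_le)
  have mono': "l ! i \<le> l ! j" if "i \<le> j" "j \<le> n" for i j
    using strict_mono_on_leD[OF mono, of i j] that by auto
  obtain i where "i \<le> n" "l ! i = a" using img assms by (metis atMost_iff imageE)
  then have "l ! 0 \<le> a" using mono'[of 0 i] by simp
  moreover have "a \<le> l ! 0" using img assms by fastforce
  moreover obtain j where "j \<le> n" "l ! j = b" using img assms by (metis atMost_iff imageE)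
  then have "b \<le> l ! n" using mono'[of j n] by simp
  moreover have "l ! n \<le> b" using img assms by fastforce
  ultimately show ?thesis using that[of "\<lambda>i. l ! i" n] mono img by auto
qed

lemma partition_locate:
  fixes z :: "nat \<Rightarrow> real"
  assumes "z 0 \<le> x" "x < z n"
  shows "\<exists>i<n. z i \<le> x \<and> x < z (Suc i)"
  using assms
proof (induction n)
  case (Suc n)
  then show ?case by (cases "x < z n") (use less_Suc_eq in auto)
qed auto

text \<open>The combinatorial content of simple zeros: the zeros enumerate the end points of the nodal domains,
  so there are exactly as many gaps as nodal domains, and the signs alternate. If the sign were the same on
  both sides of an interior zero, that zero would be a local extremum and so not simple.\<close>

lemma nodal_partition:
  fixes u u' :: "real \<Rightarrow> real"
  assumes L: "L > 0"
    and du: "\<And>x. x \<in> {0..L} \<Longrightarrow> (u has_real_derivative u' x) (at x within {0..L})"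
    and simple: "\<And>x. x \<in> {0..L} \<Longrightarrow> u x = 0 \<Longrightarrow> u' x \<noteq> 0"
    and bc: "u 0 = 0" "u L = 0"
    and k: "k = card (nodal_domains L u)"
  obtains z s where "z 0 = 0" "z k = L" "s \<in> {1, -1}"
    "\<And>i. i < k \<Longrightarrow> z i < z (Suc i) \<and> 0 \<le> z i \<and> z (Suc i) \<le> L"
    "\<And>i. i < k \<Longrightarrow> u (z i) = 0 \<and> u (z (Suc i)) = 0"
    "\<And>i x. i < k \<Longrightarrow> x \<in> {z i<..<z (Suc i)} \<Longrightarrow> s * (-1) ^ i * u x > 0"
proof -
  let ?Z = "{x \<in> {0..L}. u x = 0}"
  have cu: "continuous_on {0..L} u"
    using du by (intro DERIV_continuous_on)
  have "finite ?Z" using du simple by (rule finite_zeros_if_simple)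
  moreover have "0 \<in> ?Z" "L \<in> ?Z" "?Z \<subseteq> {0..L}" using L bc by auto
  ultimately obtain z :: "nat \<Rightarrow> real" and n where z: "z 0 = 0" "z n = L" "strict_mono_on {..n} z" "z ` {..n} = ?Z"
    by (rule finite_set_partition)
  have less: "z i < z j" if "i < j" "j \<le> n" for i j
    using strict_mono_onD[OF z(3), of i j] that by auto
  have zZ: "z i \<in> ?Z" if "i \<le> n" for i using z(4) that by blast
  have ne0: "u x \<noteq> 0" if "i < n" "x \<in> {z i<..<z (Suc i)}" for i x
  proof
    assume "u x = 0"
    moreover have "x \<in> {0..L}" using zZ[of i] zZ[of "Suc i"] that by auto
    ultimately have "x \<in> z ` {..n}" using z(4) by auto
    then obtain j where j: "j \<le> n" "x = z j" by auto
    consider "j < i" | "j = i" | "j = Suc i" | "Suc i < j" by linarith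
    then show False using that j less[of j i] less[of "Suc i" j] by cases auto
  qed
  let ?I = "\<lambda>i. {z i<..<z (Suc i)}"
  have disj: "?I i \<inter> ?I j = {}" if "i < j" "j < n" for i j
  proof -
    have "z (Suc i) \<le> z j" using less[of "Suc i" j] that by (cases "Suc i = j") auto
    then show ?thesis by auto
  qed
  have neI: "?I i \<noteq> {}" if "i < n" for i using less[of i "Suc i"] that by auto
  have inj: "inj_on ?I {..<n}"
  proof (rule inj_onI)
    fix i j assume "i \<in> {..<n}" "j \<in> {..<n}" "?I i = ?I j"
    then show "i = j" using disj[of i j] disj[of j i] neI[of i] neI[of j]
      by (cases i j rule: linorder_cases) auto
  qed
  have un: "\<Union> (?I ` {..<n}) = {x \<in> {0<..<L}. u x \<noteq> 0}"
  proof (intro equalityI subsetI)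
    fix x assume "x \<in> \<Union> (?I ` {..<n})"
    then obtain i where i: "i < n" "x \<in> ?I i" by auto
    then show "x \<in> {x \<in> {0<..<L}. u x \<noteq> 0}"
      using ne0[OF i] zZ[of i] zZ[of "Suc i"] by auto
  next
    fix x assume x: "x \<in> {x \<in> {0<..<L}. u x \<noteq> 0}"
    then obtain i where i: "i < n" "z i \<le> x" "x < z (Suc i)"
      using partition_locate[of z x n] z by auto
    moreover have "z i \<noteq> x" using zZ[of i] i x by auto
    ultimately show "x \<in> \<Union> (?I ` {..<n})" by force
  qed
  have "components {x \<in> {0<..<L}. u x \<noteq> 0} = ?I ` {..<n}"
  proof (rule components_open_unique)
    show "pairwise disjnt (?I ` {..<n})"
    proof (rule pairwiseI)
      fix A B assume "A \<in> ?I ` {..<n}" "B \<in> ?I ` {..<n}" "A \<noteq> B"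
      then obtain i j where "i < n" "j < n" "A = ?I i" "B = ?I j" "i \<noteq> j" by auto
      then show "disjnt A B" unfolding disjnt_def
        using disj[of i j] disj[of j i] by (cases i j rule: linorder_cases) auto
    qed
  qed (use un neI in auto)
  then have kn: "k = n"
    unfolding k nodal_domains_def by (simp add: card_image[OF inj])
  \<comment> \<open>The sign on a gap is read off at its midpoint.\<close>
  define w where "w = (\<lambda>i. (z i + z (Suc i)) / 2)"
  have w: "w i \<in> ?I i" if "i < n" for i
    using less[of i "Suc i"] that by (auto simp: w_def)
  have samesign: "sgn (u (w i)) * u x > 0" if "i < n" "x \<in> ?I i" for i x
  proof -
    have "connected (u ` ?I i)"
      using zZ[of i] zZ[of "Suc i"] that
      by (intro connected_continuous_image continuous_on_subset[OF cu]) auto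
    moreover have "0 \<notin> u ` ?I i" using ne0 that by force
    moreover have "u x \<in> u ` ?I i" "u (w i) \<in> u ` ?I i" using w that by auto
    ultimately have "u x > 0 \<longleftrightarrow> u (w i) > 0"
      using connectedD_interval[of "u ` ?I i" "u x" "u (w i)" 0]
        connectedD_interval[of "u ` ?I i" "u (w i)" "u x" 0]
      by (metis linorder_le_cases linorder_not_le)
    moreover have "u x \<noteq> 0" "u (w i) \<noteq> 0" using ne0 w that by auto
    ultimately show ?thesis by (auto simp: sgn_if)
  qed
  have alt: "sgn (u (w (Suc i))) = - sgn (u (w i))" if i: "Suc i < n" for i
  proof (rule ccontr)
    let ?s = "sgn (u (w i))" and ?p = "z (Suc i)"
    assume ne: "sgn (u (w (Suc i))) \<noteq> - ?s"
    have "u (w i) \<noteq> 0" "u (w (Suc i)) \<noteq> 0"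
      using ne0[of i "w i"] ne0[of "Suc i" "w (Suc i)"] w[of i] w[of "Suc i"] i by auto
    with ne have eq: "sgn (u (w (Suc i))) = ?s" by (auto simp: sgn_if split: if_splits)
    have p: "0 < ?p" "?p < L" using less[of 0 "Suc i"] less[of "Suc i" n] z i by auto
    have up: "u ?p = 0" using zZ[of "Suc i"] i by auto
    have d: "(u has_real_derivative u' ?p) (at ?p)"
      using du[of ?p] p by (simp add: at_within_Icc_at)
    define r where "r = min (?p - z i) (z (Suc (Suc i)) - ?p)"
    have r: "r > 0" using less[of i "Suc i"] less[of "Suc i" "Suc (Suc i)"] i by (auto simp: r_def)
    have "?s * u' ?p = 0"
    proof (rule DERIV_local_min[OF _ r])
      show "((\<lambda>x. ?s * u x) has_real_derivative ?s * u' ?p) (at ?p)"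
        using d by (auto intro!: derivative_eq_intros)
      show "\<forall>y. \<bar>?p - y\<bar> < r \<longrightarrow> ?s * u ?p \<le> ?s * u y"
      proof (intro allI impI)
        fix y assume y: "\<bar>?p - y\<bar> < r"
        have "z i < y" "y < z (Suc (Suc i))"
          using y unfolding r_def by linarith+
        then consider "y \<in> ?I i" | "y = ?p" | "y \<in> ?I (Suc i)"
          by fastforce
        then show "?s * u ?p \<le> ?s * u y"
          using samesign[of i y] samesign[of "Suc i" y] eq i up by cases auto
      qed
    qed
    then have "u' ?p = 0" using \<open>u (w i) \<noteq> 0\<close> by (simp add: sgn_eq_0_iff)
    then show False using simple[of ?p] p up by auto
  qed
  have alt': "sgn (u (w i)) = sgn (u (w 0)) * (-1) ^ i" if "i < n" for i
    using that by (induction i) (auto simp: alt)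
  have n0: "n > 0" using z L by (cases n) auto
  have s: "sgn (u (w 0)) \<in> {1, -1}" using ne0[OF n0 w[OF n0]] by (auto simp: sgn_if)
  show ?thesis
  proof (rule that[of z "sgn (u (w 0))"], goal_cases)
    case (4 i)
    then show ?case using zZ[of i] zZ[of "Suc i"] less[of i "Suc i"] kn by auto
  next
    case (5 i)
    then show ?case using zZ[of i] zZ[of "Suc i"] kn by auto
  next
    case (6 i x)
    then show ?case using samesign[of i x] alt'[of i] kn by auto
  qed (use z kn s in auto)
qed

section \<open>The identity on a nodal interval\<close>

text \<open>With \<open>v x = sin (pi * (x - a) / (b - a))\<close>, the Wronskian \<open>u' * v - u * v'\<close> vanishes at both end
  points, and its derivative is \<open>((pi / (b - a))\<^sup>2 - q) * u * v\<close>. By Rolle's theorem this derivative is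
  zero somewhere inside, where \<open>u\<close> and \<open>v\<close> are not. An equality at one point is better here than the
  usual two-sided eigenvalue bounds: it makes the sum over all intervals a Riemann sum.\<close>

lemma sturm_mean_value:
  fixes u u' q :: "real \<Rightarrow> real"
  assumes ab: "a < b"
    and du: "\<And>x. x \<in> {a..b} \<Longrightarrow> (u has_real_derivative u' x) (at x within {a..b})"
    and cu': "continuous_on {a..b} u'"
    and du': "\<And>x. x \<in> {a<..<b} \<Longrightarrow> (u' has_real_derivative - (q x * u x)) (at x)"
    and bc: "u a = 0" "u b = 0"
    and ne: "\<And>x. x \<in> {a<..<b} \<Longrightarrow> u x \<noteq> 0"
  obtains \<xi> where "\<xi> \<in> {a<..<b}" "q \<xi> = (pi / (b - a))\<^sup>2"
proof -
  define \<mu> where "\<mu> = pi / (b - a)"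
  define W where "W = (\<lambda>x. u' x * sin (\<mu> * (x - a)) - u x * (\<mu> * cos (\<mu> * (x - a))))"
  have cu: "continuous_on {a..b} u"
    using du by (intro DERIV_continuous_on)
  have dW: "(W has_real_derivative (\<mu>\<^sup>2 - q x) * u x * sin (\<mu> * (x - a))) (at x)"
    if x: "x \<in> {a<..<b}" for x
  proof -
    have "(u has_real_derivative u' x) (at x)"
      using du[of x] x by (simp add: at_within_Icc_at)
    then show ?thesis unfolding W_def using du'[OF x]
      by (auto intro!: derivative_eq_intros simp: algebra_simps power2_eq_square)
  qed
  have "\<mu> * (b - a) = pi" using ab by (simp add: \<mu>_def)
  then have "W a = W b" using bc by (simp add: W_def)
  moreover have "continuous_on {a..b} W"
    unfolding W_def by (intro continuous_intros cu cu')
  ultimately obtain \<xi> where \<xi>: "a < \<xi>" "\<xi> < b" "(W has_real_derivative 0) (at \<xi>)"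
    using Rolle[of a b W] ab dW by (auto simp: real_differentiable_def)
  then have "(\<mu>\<^sup>2 - q \<xi>) * u \<xi> * sin (\<mu> * (\<xi> - a)) = 0"
    using DERIV_unique[OF dW[of \<xi>] \<xi>(3)] by auto
  moreover have "sin (\<mu> * (\<xi> - a)) > 0"
  proof (rule sin_gt_zero)
    show "0 < \<mu> * (\<xi> - a)" using \<xi> ab by (simp add: \<mu>_def)
    show "\<mu> * (\<xi> - a) < pi" using \<xi> ab by (simp add: \<mu>_def field_simps)
  qed
  ultimately have "q \<xi> = \<mu>\<^sup>2" using ne[of \<xi>] \<xi> by auto
  then show ?thesis using that[of \<xi>] \<xi> by (simp add: \<mu>_def)
qed

text \<open>The mean value identity on each nodal interval of a solution, with the square root taken; \<open>s\<close> is
  the sign of the solution on the first interval, and \<open>s * (-1) ^ i\<close> its sign on the interval \<open>i\<close>.\<close>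

lemma fucik_curve_partition:
  assumes L: "L > 0" and cm: "continuous_on {0..L} m"
    and pos: "\<And>x. x \<in> {0..L} \<Longrightarrow> 0 < m x"
    and curve: "(\<alpha>, \<beta>) \<in> fucik_curve \<sigma> L m m k"
  obtains z \<xi> s where "z 0 = 0" "z k = L" "s \<in> {1, -1}"
    "\<And>i. i < k \<Longrightarrow> 0 \<le> z i \<and> z i < \<xi> i \<and> \<xi> i < z (Suc i) \<and> z (Suc i) \<le> L"
    "\<And>i. i < k \<Longrightarrow> m (\<xi> i) powr (1 / 2) * (z (Suc i) - z i) =
       pi * (if s * (-1) ^ i > (0::real) then \<alpha> powr - (1 / 2) else \<beta> powr - (1 / 2))"
proof -
  from curve obtain u u' where ab: "\<alpha> > 0" "\<beta> > 0"
    and sol: "fucik_solution L m m \<alpha> \<beta> u u'" and nz: "\<exists>x\<in>{0..L}. u x \<noteq> 0"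
    and k: "k = card (nodal_domains L u)"
    unfolding fucik_curve_def by auto
  have du: "(u has_real_derivative u' x) (at x within {0..L})" if "x \<in> {0..L}" for x
    using sol that unfolding fucik_solution_def by blast
  have cu': "continuous_on {0..L} u'" and bc: "u 0 = 0" "u L = 0"
    using sol unfolding fucik_solution_def by auto
  have du': "(u' has_real_derivative - ((if u x > 0 then \<alpha> else \<beta>) * m x * u x)) (at x)"
    if x: "x \<in> {0<..<L}" for x
  proof -
    obtain d where d: "(u' has_real_derivative d) (at x)"
      "- d = \<alpha> * m x * pos_part (u x) - \<beta> * m x * neg_part (u x)"
      using sol x unfolding fucik_solution_def by blast
    then have "d = - ((if u x > 0 then \<alpha> else \<beta>) * m x * u x)"
      by (auto simp: pos_part_def neg_part_def max_def split: if_splits)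
    then show ?thesis using d(1) by simp
  qed
  obtain M where M: "\<And>x. x \<in> {0..L} \<Longrightarrow> m x \<le> M"
    using compact_continuous_image[OF cm compact_Icc, THEN compact_imp_bounded, THEN bounded_imp_bdd_above]
    unfolding bdd_above_def by (auto simp del: atLeastAtMost_iff)
  have simple: "u' x \<noteq> 0" if x: "x \<in> {0..L}" "u x = 0" for x
  proof
    assume ux: "u' x = 0"
    have bd: "\<exists>d. (u' has_real_derivative d) (at t) \<and> \<bar>d\<bar> \<le> (max \<alpha> \<beta> * M) * \<bar>u t\<bar>"
      if t: "t \<in> {0<..<L}" for t
    proof (intro exI conjI)
      show "(u' has_real_derivative - ((if u t > 0 then \<alpha> else \<beta>) * m t * u t)) (at t)"
        by (rule du'[OF t])
      have "0 < m t" "m t \<le> M" using t pos[of t] M[of t] by auto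
      then have "(if u t > 0 then \<alpha> else \<beta>) * m t \<le> max \<alpha> \<beta> * M"
        using ab by (intro mult_mono) auto
      then show "\<bar>- ((if u t > 0 then \<alpha> else \<beta>) * m t * u t)\<bar> \<le> (max \<alpha> \<beta> * M) * \<bar>u t\<bar>"
        using ab \<open>0 < m t\<close> mult_right_mono[of _ "max \<alpha> \<beta> * M" "\<bar>u t\<bar>"]
        by (simp add: abs_mult split: if_splits)
    qed
    have "u y = 0" if "y \<in> {0..L}" for y
      by (rule linear_bound_unique_zero[OF du cu' bd x(1) x(2) ux that])
    then show False using nz by blast
  qed
  obtain z s where z: "z 0 = 0" "z k = L" "s \<in> {1, -1}"
    "\<And>i. i < k \<Longrightarrow> z i < z (Suc i) \<and> 0 \<le> z i \<and> z (Suc i) \<le> L"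
    "\<And>i. i < k \<Longrightarrow> u (z i) = 0 \<and> u (z (Suc i)) = 0"
    "\<And>i x. i < k \<Longrightarrow> x \<in> {z i<..<z (Suc i)} \<Longrightarrow> s * (-1) ^ i * u x > 0"
    using nodal_partition[OF L du simple bc k] by blast
  have "\<exists>\<xi>. z i < \<xi> \<and> \<xi> < z (Suc i) \<and> m \<xi> powr (1 / 2) * (z (Suc i) - z i) =
      pi * (if s * (-1) ^ i > 0 then \<alpha> powr - (1 / 2) else \<beta> powr - (1 / 2))" if i: "i < k" for i
  proof -
    define l where "l = (if s * (-1) ^ i > 0 then \<alpha> else \<beta>)"
    have l: "l > 0" using ab by (simp add: l_def)
    define h where "h = z (Suc i) - z i"
    have h: "h > 0" using z(4)[OF i] by (simp add: h_def)
    have sub: "{z i..z (Suc i)} \<subseteq> {0..L}" using z(4)[OF i] by auto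
    have ne: "u x \<noteq> 0" "(if u x > 0 then \<alpha> else \<beta>) = l" if "x \<in> {z i<..<z (Suc i)}" for x
    proof -
      have "u x \<noteq> 0 \<and> (u x > 0 \<longleftrightarrow> g > 0)" if "g * u x > 0" for g
        using that by (auto simp: zero_less_mult_iff)
      from this[OF z(6)[OF i that]] show "u x \<noteq> 0" "(if u x > 0 then \<alpha> else \<beta>) = l"
        by (simp_all add: l_def)
    qed
    obtain \<xi> where \<xi>: "\<xi> \<in> {z i<..<z (Suc i)}" "l * m \<xi> = (pi / h)\<^sup>2"
      unfolding h_def
    proof (rule sturm_mean_value[of "z i" "z (Suc i)" u u' "\<lambda>x. l * m x"])
      show "(u has_real_derivative u' x) (at x within {z i..z (Suc i)})"
        if "x \<in> {z i..z (Suc i)}" for x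
        using du[of x] sub that by (blast intro: DERIV_subset)
      show "(u' has_real_derivative - (l * m x * u x)) (at x)" if "x \<in> {z i<..<z (Suc i)}" for x
        using du'[of x] ne(2)[OF that] z(4)[OF i] that by auto
    qed (use z(4,5)[OF i] ne cu' sub in \<open>auto intro: continuous_on_subset\<close>)
    have m: "m \<xi> > 0" using pos[of \<xi>] \<xi>(1) sub by auto
    have "sqrt (l * m \<xi>) = pi / h" using \<xi>(2) h by simp
    then have "sqrt (m \<xi>) * h = pi / sqrt l"
      using l h by (simp add: real_sqrt_mult field_simps)
    then have "m \<xi> powr (1 / 2) * h = pi * l powr - (1 / 2)"
      using m l by (simp add: powr_half_sqrt powr_minus_divide)
    then show ?thesis using \<xi>(1) by (auto simp: h_def l_def)
  qed
  then obtain \<xi> where "\<And>i. i < k \<Longrightarrow> z i < \<xi> i \<and> \<xi> i < z (Suc i) \<and>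
      m (\<xi> i) powr (1 / 2) * (z (Suc i) - z i) =
      pi * (if s * (-1) ^ i > 0 then \<alpha> powr - (1 / 2) else \<beta> powr - (1 / 2))" by metis
  then show ?thesis using that[of z s \<xi>] z by blast
qed

section \<open>Summing over the nodal intervals\<close>

lemma riemann_sum_error:
  fixes f :: "real \<Rightarrow> real" and z \<xi> :: "nat \<Rightarrow> real"
  assumes "\<And>i. i < n \<Longrightarrow> z i \<le> z (Suc i)"
    and "continuous_on {z 0..z n} f"
    and "\<And>i x. i < n \<Longrightarrow> x \<in> {z i..z (Suc i)} \<Longrightarrow> \<bar>f x - f (\<xi> i)\<bar> \<le> e"
  shows "z 0 \<le> z n \<and> \<bar>integral {z 0..z n} f - (\<Sum>i<n. f (\<xi> i) * (z (Suc i) - z i))\<bar> \<le> e * (z n - z 0)"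
  using assms
proof (induction n)
  case (Suc n)
  let ?a = "z 0" and ?b = "z n" and ?c = "z (Suc n)"
  have bc: "?b \<le> ?c" using Suc.prems(1) by simp
  have "continuous_on {?a..?b} f"
    using Suc.prems(2) by (rule continuous_on_subset) (use bc in auto)
  then have "?a \<le> ?b \<and>
      \<bar>integral {?a..?b} f - (\<Sum>i<n. f (\<xi> i) * (z (Suc i) - z i))\<bar> \<le> e * (?b - ?a)"
    by (intro Suc.IH) (use Suc.prems in auto)
  then have ab: "?a \<le> ?b"
    and IH: "\<bar>integral {?a..?b} f - (\<Sum>i<n. f (\<xi> i) * (z (Suc i) - z i))\<bar> \<le> e * (?b - ?a)"
    by auto
  have cont: "continuous_on {?b..?c} f"
    using Suc.prems(2) by (rule continuous_on_subset) (use ab in auto)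
  have int: "f integrable_on {?a..?c}" "f integrable_on {?b..?c}"
    using Suc.prems(2) cont by (auto intro: integrable_continuous_interval)
  have split: "integral {?a..?b} f + integral {?b..?c} f = integral {?a..?c} f"
    by (rule Henstock_Kurzweil_Integration.integral_combine[OF ab bc int(1)])
  have "integral {?b..?c} (\<lambda>x. f x - f (\<xi> n)) = integral {?b..?c} f - f (\<xi> n) * (?c - ?b)"
    using int(2) bc by (subst integral_diff) auto
  moreover have "norm (integral {?b..?c} (\<lambda>x. f x - f (\<xi> n))) \<le> e * (?c - ?b)"
    using Suc.prems(3)[of n] bc cont by (intro integral_bound continuous_intros) auto
  ultimately show ?case using IH split ab bc by (auto simp: algebra_simps)
qed auto

text \<open>For even \<open>k\<close> the two values occur equally often; for odd \<open>k\<close> the value taken at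
  \<open>i = 0\<close> occurs once more than the other.\<close>

lemma sum_alternating:
  fixes a b s :: real
  assumes "s \<in> {1, -1}"
  shows "\<bar>(\<Sum>i<k. if s * (-1) ^ i > 0 then a else b) - real k / 2 * (a + b)\<bar> \<le> \<bar>a - b\<bar> / 2"
proof -
  have "(\<Sum>i<k. if s * (-1) ^ i > 0 then a else b) - real k / 2 * (a + b)
      = (if even k then 0 else s * (a - b) / 2)"
    using assms by (induction k) (auto simp: algebra_simps field_simps)
  then show ?thesis using assms by (auto simp: abs_mult)
qed

section \<open>Points of the sector\<close>

text \<open>The rays that bound the sector stay away from the axes since \<open>\<theta> < pi / 2\<close>: both the sine and the
  cosine of the polar angle are at least \<open>t = sin (pi / 4 - \<theta> / 2) > 0\<close>.\<close>

lemma sector_comparable: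
  assumes "0 < \<theta>" "\<theta> < pi / 2"
  obtains t where "0 < t" "\<And>\<alpha> \<beta>. (\<alpha>, \<beta>) \<in> sector \<theta> \<Longrightarrow> 0 < \<alpha> \<and> 0 < \<beta> \<and> t * \<alpha> \<le> \<beta> \<and> t * \<beta> \<le> \<alpha>"
proof -
  define t where "t = sin (pi / 4 - \<theta> / 2)"
  have t: "t > 0" unfolding t_def using assms pi_gt_zero by (intro sin_gt_zero) linarith+
  show ?thesis
  proof (rule that[OF t])
    fix \<alpha> \<beta> assume "(\<alpha>, \<beta>) \<in> sector \<theta>"
    then obtain r \<phi> where r: "r > 0" "\<alpha> = r * cos \<phi>" "\<beta> = r * sin \<phi>" and
      p: "\<bar>\<phi> - pi / 4\<bar> \<le> \<theta> / 2" unfolding sector_def by auto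
    have s: "t \<le> sin \<phi>" unfolding t_def using p assms by (intro sin_monotone_2pi_le) linarith+
    have "t \<le> sin (pi / 2 - \<phi>)"
      unfolding t_def using p assms by (intro sin_monotone_2pi_le) linarith+
    then have c: "t \<le> cos \<phi>" by (simp add: sin_diff)
    have "t * cos \<phi> \<le> t" "t * sin \<phi> \<le> t"
      using t by (auto intro: mult_left_le)
    then have "t * cos \<phi> \<le> sin \<phi>" "t * sin \<phi> \<le> cos \<phi>"
      using s c by linarith+
    moreover have "cos \<phi> > 0" "sin \<phi> > 0" using s c t by linarith+
    ultimately show "0 < \<alpha> \<and> 0 < \<beta> \<and> t * \<alpha> \<le> \<beta> \<and> t * \<beta> \<le> \<alpha>"
      using r by (simp add: mult.left_commute)
  qed
qed

lemma powr_neg_half_comparable: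
  fixes t x y :: real
  assumes "0 < t" "0 < x" "0 < y" "t * y \<le> x"
  shows "x powr - (1 / 2) \<le> t powr - (1 / 2) * y powr - (1 / 2)"
proof -
  have "x powr - (1 / 2) \<le> (t * y) powr - (1 / 2)"
    using assms by (intro powr_mono2') auto
  then show ?thesis using assms by (simp add: powr_mult)
qed

section \<open>Asymptotics of the Fucik curves\<close>

theorem theorem1p2:
  fixes L c \<theta> \<sigma> :: real and m :: "real \<Rightarrow> real" and \<alpha> \<beta> :: "nat \<Rightarrow> real"
  assumes "L > 0"
    and "continuous_on {0..L} m"
    and "c > 0" and "\<And>x. x \<in> {0..L} \<Longrightarrow> c \<le> m x"
    and "0 < \<theta>" and "\<theta> < pi / 2"
    and "\<sigma> \<in> {1, -1}"
    and "\<And>k. k \<ge> 1 \<Longrightarrow> (\<alpha> k, \<beta> k) \<in> fucik_curve \<sigma> L m m k \<inter> sector \<theta>"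
  shows "(\<lambda>k. 1) \<sim>[at_top] (\<lambda>k. pi * real k / 2 *
           ((\<alpha> k powr (- (1 / 2)) + \<beta> k powr (- (1 / 2))) /
            integral {0..L} (\<lambda>x. m x powr (1 / 2))))"
proof -
  define f where "f = (\<lambda>x. m x powr (1 / 2))"
  define a where "a = (\<lambda>k. \<alpha> k powr - (1 / 2))"
  define b where "b = (\<lambda>k. \<beta> k powr - (1 / 2))"
  define T where "T = integral {0..L} f"
  define c' where "c' = c powr (1 / 2)"
  have mpos: "0 < m x" if "x \<in> {0..L}" for x using assms(3,4) that by force
  have c': "c' > 0" using assms(3) by (simp add: c'_def)
  have fge: "c' \<le> f x" if "x \<in> {0..L}" for x
    unfolding f_def c'_def using assms(3,4) that by (intro powr_mono2) auto
  have cf: "continuous_on {0..L} f" unfolding f_def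
    using mpos by (intro continuous_on_powr assms(2) continuous_on_const) force
  have "c' * L \<le> T"
  proof -
    have "integral {0..L} (\<lambda>x. c') \<le> T" unfolding T_def
      using fge cf by (intro integral_le) (auto intro: integrable_continuous_interval)
    then show ?thesis using assms(1) by (simp add: mult.commute)
  qed
  then have T: "T > 0" using c' assms(1) by (smt (verit) mult_pos_pos)
  obtain F where F: "\<And>x. x \<in> {0..L} \<Longrightarrow> f x \<le> F"
    using compact_continuous_image[OF cf compact_Icc, THEN compact_imp_bounded, THEN bounded_imp_bdd_above]
    unfolding bdd_above_def by (auto simp del: atLeastAtMost_iff)
  obtain t where t: "0 < t"
    "\<And>\<alpha> \<beta>. (\<alpha>, \<beta>) \<in> sector \<theta> \<Longrightarrow> 0 < \<alpha> \<and> 0 < \<beta> \<and> t * \<alpha> \<le> \<beta> \<and> t * \<beta> \<le> \<alpha>"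
    using sector_comparable[OF assms(5,6)] by blast
  define K where "K = 1 + t powr - (1 / 2)"
  have K: "K > 0" using t by (simp add: K_def add_pos_pos)
  have sec: "0 < a k" "0 < b k" "a k + b k \<le> K * a k" "a k + b k \<le> K * b k" if "k \<ge> 1" for k
  proof -
    have *: "0 < \<alpha> k" "0 < \<beta> k" "t * \<alpha> k \<le> \<beta> k" "t * \<beta> k \<le> \<alpha> k"
      using t(2)[of "\<alpha> k" "\<beta> k"] assms(8)[OF that] by auto
    then show "0 < a k" "0 < b k" by (auto simp: a_def b_def)
    show "a k + b k \<le> K * a k" "a k + b k \<le> K * b k"
      using powr_neg_half_comparable[of t "\<alpha> k" "\<beta> k"] powr_neg_half_comparable[of t "\<beta> k" "\<alpha> k"] t(1) *
      by (auto simp: K_def a_def b_def algebra_simps)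
  qed
  have part: "\<exists>z \<xi> s. z 0 = 0 \<and> z k = L \<and> s \<in> {1, -1} \<and>
     (\<forall>i<k. 0 \<le> z i \<and> z i < \<xi> i \<and> \<xi> i < z (Suc i) \<and> z (Suc i) \<le> L \<and>
     f (\<xi> i) * (z (Suc i) - z i) = pi * (if s * (-1) ^ i > (0::real) then a k else b k))"
    if "k \<ge> 1" for k
  proof -
    have "(\<alpha> k, \<beta> k) \<in> fucik_curve \<sigma> L m m k" using assms(8)[OF that] by simp
    then obtain z \<xi> s where
      "z 0 = 0" "z k = L" "s \<in> {1, -1}"
      "\<And>i. i < k \<Longrightarrow> 0 \<le> z i \<and> z i < \<xi> i \<and> \<xi> i < z (Suc i) \<and> z (Suc i) \<le> L"
      "\<And>i. i < k \<Longrightarrow> m (\<xi> i) powr (1 / 2) * (z (Suc i) - z i) =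
       pi * (if s * (-1) ^ i > (0::real) then \<alpha> k powr - (1 / 2) else \<beta> k powr - (1 / 2))"
      using fucik_curve_partition[OF assms(1,2) mpos] by metis
    then show ?thesis unfolding f_def a_def b_def
      by (intro exI[of _ z] exI[of _ \<xi>] exI[of _ s]) auto
  qed
  \<comment> \<open>Each interval has length at least \<open>pi * min (a k) (b k) / F\<close>, and \<open>k\<close> of them fit into \<open>{0..L}\<close>;
    comparability in the sector turns the minimum into the sum.\<close>
  have small: "a k + b k \<le> (K * F * L / pi) * inverse (real k)" if "k \<ge> 1" for k
  proof -
    from part[OF that] obtain z \<xi> s where z: "z 0 = 0" "z k = L" and
      i: "\<And>i. i < k \<Longrightarrow> 0 \<le> z i \<and> z i < \<xi> i \<and> \<xi> i < z (Suc i) \<and> z (Suc i) \<le> L \<and>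
     f (\<xi> i) * (z (Suc i) - z i) = pi * (if s * (-1) ^ i > (0::real) then a k else b k)" by blast
    have "(\<Sum>i<k. pi * (a k + b k)) \<le> (\<Sum>i<k. K * F * (z (Suc i) - z i))"
    proof (rule sum_mono)
      fix i assume "i \<in> {..<k}"
      then have ii: "0 \<le> z i" "z i < \<xi> i" "\<xi> i < z (Suc i)" "z (Suc i) \<le> L"
        "f (\<xi> i) * (z (Suc i) - z i) = pi * (if s * (-1) ^ i > (0::real) then a k else b k)"
        using i[of i] by auto
      have "pi * (a k + b k) \<le> pi * (K * (if s * (-1) ^ i > (0::real) then a k else b k))"
        using sec[OF that] by auto
      also have "\<dots> = K * (f (\<xi> i) * (z (Suc i) - z i))" using ii(5) by simp
      also have "\<dots> \<le> K * (F * (z (Suc i) - z i))"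
        using K F[of "\<xi> i"] ii by (intro mult_left_mono mult_right_mono) auto
      finally show "pi * (a k + b k) \<le> K * F * (z (Suc i) - z i)" by simp
    qed
    also have "\<dots> = K * F * L"
      using z by (simp add: sum_distrib_left[symmetric] sum_lessThan_telescope)
    finally have "real k * (pi * (a k + b k)) \<le> K * F * L" by simp
    then show ?thesis using that by (simp add: field_simps)
  qed
  have ab0: "(\<lambda>k. a k + b k) \<longlonglongrightarrow> 0"
  proof (rule tendsto_sandwich)
    show "\<forall>\<^sub>F k in sequentially. 0 \<le> a k + b k"
      using sec by (intro eventually_sequentiallyI[of 1]) (simp add: add_nonneg_nonneg less_imp_le)
    show "\<forall>\<^sub>F k in sequentially. a k + b k \<le> (K * F * L / pi) * inverse (real k)"
      using small by (intro eventually_sequentiallyI[of 1])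
    show "(\<lambda>k. (K * F * L / pi) * inverse (real k)) \<longlonglongrightarrow> 0"
      by (intro tendsto_mult_right_zero lim_inverse_n)
  qed auto
  have lim: "(\<lambda>k. pi * real k / 2 * (a k + b k)) \<longlonglongrightarrow> T"
  proof (rule LIMSEQ_I)
    fix r :: real assume r: "r > 0"
    \<comment> \<open>Half of the tolerance \<open>r\<close> goes to the Riemann sum, half to the parity error.\<close>
    define e where "e = r / (2 * L)"
    have e: "e > 0" using r assms(1) by (simp add: e_def)
    have "uniformly_continuous_on {0..L} f"
      using cf by (intro compact_uniformly_continuous) auto
    then obtain d where d: "d > 0"
      "\<And>x y. x \<in> {0..L} \<Longrightarrow> y \<in> {0..L} \<Longrightarrow> \<bar>x - y\<bar> < d \<Longrightarrow> \<bar>f x - f y\<bar> < e"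
      using e unfolding uniformly_continuous_on_def dist_real_def by metis
    have "\<forall>\<^sub>F k in sequentially. a k + b k < min (d * c' / pi) (r / pi)"
      using d(1) c' r by (intro order_tendstoD(2)[OF ab0]) simp
    then obtain N where N: "\<And>k. k \<ge> N \<Longrightarrow> a k + b k < min (d * c' / pi) (r / pi)"
      by (auto simp: eventually_sequentially)
    show "\<exists>N. \<forall>k\<ge>N. norm (pi * real k / 2 * (a k + b k) - T) < r"
    proof (intro exI[of _ "max 1 N"] allI impI)
      fix k assume "k \<ge> max 1 N"
      then have k: "k \<ge> 1" and kN: "pi * (a k + b k) < d * c'" "pi * (a k + b k) < r"
        using N[of k] by (auto simp: field_simps)
      note s = sec[OF k]
      from part[OF k] obtain z \<xi> s where z: "z 0 = 0" "z k = L" "s \<in> {1, -1}" and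
        i: "\<And>i. i < k \<Longrightarrow> 0 \<le> z i \<and> z i < \<xi> i \<and> \<xi> i < z (Suc i) \<and> z (Suc i) \<le> L \<and>
       f (\<xi> i) * (z (Suc i) - z i) = pi * (if s * (-1) ^ i > (0::real) then a k else b k)" by blast
      have mesh: "z (Suc i) - z i < d" if "i < k" for i
      proof -
        have "c' * (z (Suc i) - z i) \<le> f (\<xi> i) * (z (Suc i) - z i)"
          using i[OF that] fge[of "\<xi> i"] by (intro mult_right_mono) auto
        also have "\<dots> \<le> pi * (a k + b k)" using i[OF that] s by auto
        also have "\<dots> < c' * d" using kN by (simp add: mult.commute)
        finally show ?thesis using c' by simp
      qed
      have "\<bar>integral {z 0..z k} f - (\<Sum>i<k. f (\<xi> i) * (z (Suc i) - z i))\<bar> \<le> e * (z k - z 0)"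
      proof (rule riemann_sum_error[THEN conjunct2])
        fix j assume j: "j < k"
        show "z j \<le> z (Suc j)" using i[OF j] by linarith
        fix x assume "x \<in> {z j..z (Suc j)}"
        then have "\<bar>f x - f (\<xi> j)\<bar> < e"
          using i[OF j] mesh[OF j] by (intro d(2)) auto
        then show "\<bar>f x - f (\<xi> j)\<bar> \<le> e" by simp
      qed (use z cf in simp)
      then have R: "\<bar>T - (\<Sum>i<k. f (\<xi> i) * (z (Suc i) - z i))\<bar> \<le> r / 2"
        using z assms(1) by (simp add: T_def e_def)
      have "(\<Sum>i<k. f (\<xi> i) * (z (Suc i) - z i)) =
          pi * (\<Sum>i<k. if s * (-1) ^ i > 0 then a k else b k)"
        unfolding sum_distrib_left by (rule sum.cong) (use i in auto)
      then have "(\<Sum>i<k. f (\<xi> i) * (z (Suc i) - z i)) - pi * real k / 2 * (a k + b k)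
          = pi * ((\<Sum>i<k. if s * (-1) ^ i > 0 then a k else b k) - real k / 2 * (a k + b k))"
        by (simp only:) (simp add: algebra_simps)
      then have "\<bar>(\<Sum>i<k. f (\<xi> i) * (z (Suc i) - z i)) - pi * real k / 2 * (a k + b k)\<bar>
          = pi * \<bar>(\<Sum>i<k. if s * (-1) ^ i > 0 then a k else b k) - real k / 2 * (a k + b k)\<bar>"
        by (simp only: abs_mult) simp
      also have "\<dots> \<le> pi * (\<bar>a k - b k\<bar> / 2)"
        using sum_alternating[OF z(3), of "a k" "b k" k] by (intro mult_left_mono) auto
      also have "\<dots> \<le> pi * ((a k + b k) / 2)"
        using s by (intro mult_left_mono) auto
      also have "\<dots> < r / 2" using kN by simp
      finally show "norm (pi * real k / 2 * (a k + b k) - T) < r"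
        using R unfolding real_norm_def by linarith
    qed
  qed
  have "(\<lambda>k. pi * real k / 2 * (a k + b k) / T) \<longlonglongrightarrow> T / T"
    using T by (intro tendsto_divide lim tendsto_const) auto
  then have "(\<lambda>k. pi * real k / 2 * ((a k + b k) / T)) \<longlonglongrightarrow> 1" using T by simp
  then have "(\<lambda>k. pi * real k / 2 * ((a k + b k) / T)) \<sim>[at_top] (\<lambda>k. 1)"
    by (intro asymp_equivI') simp
  then show ?thesis
    unfolding a_def b_def T_def f_def by (rule asymp_equiv_symI)
qed

end
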